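(* Let $k\ge 1$ and let $g_1(k,1)$ be an element of $\mathcal{G}_1(k,1)$. Then $$|\det(g_1(k,1))|\le 2^k\,\Theta_k\,\Theta_{k+1}.$$
   Context: $1_m$ denotes the all-ones column vector of length $m$, and $*$ denotes the Schur (entrywise) product. For $m\ge 1$, $\mathcal{M}_m\{-1,1\}$ is the set of non-singular $m\times m$ matrices with entries in $\{-1,1\}$ whose first column is $1_m$, and $\Theta_m$ is the maximum of $|\det(M)|$ over $M\in\mathcal{M}_m\{-1,1\}$. $\mathcal{G}_1(k,1)$ is the set of saturated design matrices for the mean $F_0$, the main effects $F_1,\dots,F_k$, the two-factor interactions $F_{12},\dots,F_{1k}$ and one extra main effect $F_1^e$ in a two-level factorial experiment with $k+1$ factors. That is, it is the set of non-singular $(2k+1)\times(2k+1)$ matrices with entries in $\{-1,1\}$ whose columns are, in this order, $F_1,\dots,F_k,F_{11},F_{12},\dots,F_{1k},F_1^e$, where $F_{1j}=F_1*F_j$ for $1\le j\le k$ (so $F_{11}=F_0=1_{2k+1}$) and $F_1^e$ is an arbitrary $\{-1,1\}$-vector. *)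

theory Defs
  imports "Jordan_Normal_Form.Determinant"
begin

definition ones_vec :: "nat \<Rightarrow> real vec" where
  "ones_vec m = vec m (\<lambda>_. 1)"

definition schur_prod :: "real vec \<Rightarrow> real vec \<Rightarrow> real vec" (infixl \<open>\<star>\<close> 70) where
  "v \<star> w = vec (dim_vec v) (\<lambda>i. v $ i * w $ i)"

definition sign_mats :: "nat \<Rightarrow> real mat set" where
  "sign_mats m = {M \<in> carrier_mat m m. elements_mat M \<subseteq> {-1, 1} \<and> det M \<noteq> 0}"

text \<open>The sets \<open>\<M>\<^sub>m{-1,1}\<close> and the maxima \<open>\<Theta>\<^sub>m\<close>, meant for \<open>m \<ge> 1\<close> only.\<close>

definition normalized_sign_mats :: "nat \<Rightarrow> real mat set" where
  "normalized_sign_mats m = {M \<in> sign_mats m. col M 0 = ones_vec m}"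

definition Theta :: "nat \<Rightarrow> real" where
  "Theta m = Max ((\<lambda>M. \<bar>det M\<bar>) ` normalized_sign_mats m)"

text \<open>\<open>G\<^sub>1(k,1)\<close>: the factors \<open>F\<close> are indexed from 1 as in the mathematics; values of \<open>F\<close>
  outside \<open>{1..k}\<close> are irrelevant. The entries being signs, the column \<open>F 1 \<star> F 1\<close> is the
  all-ones vector of the mean.\<close>

definition G1_one :: "nat \<Rightarrow> real mat set" where
  "G1_one k = {D \<in> sign_mats (2 * k + 1).
     \<exists>F e. (\<forall>j\<in>{1..k}. F j \<in> carrier_vec (2 * k + 1)) \<and> e \<in> carrier_vec (2 * k + 1) \<and>
       D = mat_of_cols (2 * k + 1)
             (map F [1..<k + 1] @ map (\<lambda>j. F 1 \<star> F j) [1..<k + 1] @ [e])}"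

text \<open>The maximum defining \<open>Theta\<close> is over a finite nonempty set.\<close>

lemma finite_sign_mats: "finite (sign_mats m)"
proof -
  have "sign_mats m \<subseteq> (\<lambda>f. mat m m f) ` (({..<m} \<times> {..<m}) \<rightarrow>\<^sub>E {-1, 1})"
  proof
    fix M assume M: "M \<in> sign_mats m"
    let ?f = "restrict (\<lambda>p. M $$ p) ({..<m} \<times> {..<m})"
    have "M = mat m m ?f"
      using M by (intro eq_matI) (auto simp: sign_mats_def)
    moreover have "?f \<in> ({..<m} \<times> {..<m}) \<rightarrow>\<^sub>E {-1, 1}"
    proof (rule restrict_PiE_iff[THEN iffD2], rule ballI)
      fix p assume "p \<in> {..<m} \<times> {..<m}"
      then obtain i j where p: "p = (i, j)" "i < m" "j < m" by auto
      have "M $$ (i, j) \<in> elements_mat M"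
        using M p by (intro elements_matI[of M m m i j]) (auto simp: sign_mats_def)
      then show "M $$ p \<in> {-1, 1}" using M p by (auto simp: sign_mats_def)
    qed
    ultimately show "M \<in> (\<lambda>f. mat m m f) ` (({..<m} \<times> {..<m}) \<rightarrow>\<^sub>E {-1, 1})"
      by blast
  qed
  then show ?thesis
    by (rule finite_subset) (intro finite_imageI finite_PiE, auto)
qed

lemma finite_normalized_sign_mats: "finite (normalized_sign_mats m)"
  by (rule finite_subset[OF _ finite_sign_mats]) (auto simp: normalized_sign_mats_def)

lemma normalized_sign_mats_nonempty:
  assumes "m \<ge> 1"
  shows "normalized_sign_mats m \<noteq> {}"
proof -
  define A :: "real mat" where "A = mat m m (\<lambda>(i, j). if j \<le> i then 1 else -1)"
  have A: "A \<in> carrier_mat m m" by (simp add: A_def)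
  have "det A \<noteq> 0"
  proof
    assume "det A = 0"
    then obtain v where v: "v \<in> carrier_vec m" "v \<noteq> 0\<^sub>v m" "A *\<^sub>v v = 0\<^sub>v m"
      using det_0_iff_vec_prod_zero[OF A] by blast
    have row: "(\<Sum>j<m. (if j \<le> i then 1 else -1) * v $ j) = 0" if "i < m" for i
    proof -
      have "(A *\<^sub>v v) $ i = 0" using v that by simp
      then show ?thesis using v that
        by (simp add: A_def scalar_prod_def lessThan_atLeast0)
    qed
    have z: "v $ Suc i = 0" if i: "Suc i < m" for i
    proof -
      have "0 = (\<Sum>j<m. (if j \<le> Suc i then 1 else -1) * v $ j)
                - (\<Sum>j<m. (if j \<le> i then 1 else -1) * v $ j)"
        using row[of i] row[of "Suc i"] i by simp
      also have "\<dots> = (\<Sum>j<m. if j = Suc i then 2 * v $ j else 0)"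
        unfolding sum_subtractf[symmetric] by (rule sum.cong) auto
      also have "\<dots> = 2 * v $ Suc i" using i by simp
      finally show ?thesis by simp
    qed
    have z': "v $ j = 0" if "j < m" "j \<noteq> 0" for j
      using z[of "j - 1"] that by simp
    have "0 = (\<Sum>j<m. (if j \<le> 0 then 1 else -1) * v $ j)"
      using row[of 0] assms by simp
    also have "\<dots> = (\<Sum>j<m. if j = 0 then v $ j else 0)"
      by (rule sum.cong) (auto simp: z')
    also have "\<dots> = v $ 0" using assms by simp
    finally have z0: "v $ 0 = 0" by simp
    have "v = 0\<^sub>v m"
    proof (rule eq_vecI)
      fix j assume "j < dim_vec (0\<^sub>v m :: real vec)"
      then show "v $ j = 0\<^sub>v m $ j" using z0 z'[of j] by (cases "j = 0") auto
    qed (use v(1) in simp)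
    with v(2) show False by simp
  qed
  moreover have "elements_mat A \<subseteq> {-1, 1}" by (auto simp: A_def elements_mat_def)
  moreover have "col A 0 = ones_vec m"
    using assms by (intro eq_vecI) (auto simp: A_def ones_vec_def)
  ultimately show ?thesis
    using A by (auto simp: normalized_sign_mats_def sign_mats_def)
qed

end

theory Submission
  imports Defs
begin

text \<open>The row of \<open>D\<close> belonging to a run in which the first factor has level \<open>s\<close> is
  \<open>(x, s x, e)\<close> with \<open>s\<close> the first entry of \<open>x\<close>. Let \<open>\<sigma>\<close> be the level taken by at least
  \<open>k + 1\<close> of the \<open>2 k + 1\<close> runs, and put \<open>k + 1\<close> such runs on top and the column \<open>e\<close> in
  position \<open>k + 1\<close>. Subtracting \<open>\<sigma>\<close> times the main effects from the interactions makes the upper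
  right block vanish and turns the lower right block into \<open>(s - \<sigma>) x\<close>. Non-singularity forces
  \<open>s = -\<sigma>\<close> in all of the \<open>k\<close> lower rows, so \<open>\<bar>det D\<bar>\<close> is \<open>2\<^sup>k\<close> times the product of the
  determinants of two sign matrices, of orders \<open>k + 1\<close> and \<open>k\<close>, with constant first column.\<close>

lemma sign_mats_entry:
  assumes "M \<in> sign_mats m" "i < m" "j < m"
  shows "M $$ (i, j) = 1 \<or> M $$ (i, j) = -1"
  using assms elements_matI[of M m m i j] by (auto simp: sign_mats_def)

lemma sign_matsI:
  assumes "M \<in> carrier_mat m m" "det M \<noteq> 0"
    and "\<And>i j. i < m \<Longrightarrow> j < m \<Longrightarrow> M $$ (i, j) = 1 \<or> M $$ (i, j) = -1"
  shows "M \<in> sign_mats m"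
  using assms by (fastforce simp: sign_mats_def elements_mat_def)

text \<open>Scaling by \<tau> turns the first column into all ones and changes the determinant only
  by the sign \<open>\<tau> ^ m\<close>. Thus a block whose first column is constantly -1 is covered
  as well.\<close>

lemma abs_det_le_Theta:
  assumes M: "M \<in> sign_mats m" and m: "m \<ge> 1" and \<tau>: "\<tau> = 1 \<or> \<tau> = -1"
    and col: "\<And>i. i < m \<Longrightarrow> M $$ (i, 0) = \<tau>"
  shows "\<bar>det M\<bar> \<le> Theta m"
proof -
  have c: "M \<in> carrier_mat m m" and d: "det M \<noteq> 0"
    using M by (auto simp: sign_mats_def)
  have abs: "\<bar>det (\<tau> \<cdot>\<^sub>m M)\<bar> = \<bar>det M\<bar>"
    using \<tau> by (auto simp: abs_mult power_abs)
  have "\<tau> \<cdot>\<^sub>m M \<in> sign_mats m"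
  proof (rule sign_matsI)
    fix i j assume "i < m" "j < m"
    then show "(\<tau> \<cdot>\<^sub>m M) $$ (i, j) = 1 \<or> (\<tau> \<cdot>\<^sub>m M) $$ (i, j) = -1"
      using sign_mats_entry[OF M, of i j] \<tau> c by auto
  qed (use c d \<tau> in auto)
  moreover have "col (\<tau> \<cdot>\<^sub>m M) 0 = ones_vec m"
    using c m col \<tau> by (intro eq_vecI) (auto simp: ones_vec_def)
  ultimately have "\<tau> \<cdot>\<^sub>m M \<in> normalized_sign_mats m"
    by (simp add: normalized_sign_mats_def)
  then have "\<bar>det (\<tau> \<cdot>\<^sub>m M)\<bar> \<le> Theta m"
    unfolding Theta_def by (intro Max_ge finite_imageI finite_normalized_sign_mats imageI)
  then show ?thesis using abs by simp
qed

lemma det_zero_row: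
  fixes A :: "'a :: comm_ring_1 mat"
  assumes A: "A \<in> carrier_mat n n" and i: "i < n" and z: "\<And>j. j < n \<Longrightarrow> A $$ (i, j) = 0"
  shows "det A = 0"
  unfolding laplace_expansion_row[OF A i] using z by simp

lemma abs_det_permute_rows_cols:
  fixes A :: "real mat"
  assumes A: "A \<in> carrier_mat n n" and r: "r permutes {0..<n}" and c: "c permutes {0..<n}"
  shows "\<bar>det (mat n n (\<lambda>(i, j). A $$ (r i, c j)))\<bar> = \<bar>det A\<bar>"
proof -
  \<comment> \<open>\<open>det_permute_rows\<close> only moves rows, so the columns of
    \<open>A\<close> are permuted as rows of its transpose; the transpose of \<open>B\<close> is
    then \<open>A\<close> with permuted columns.\<close>
  define B where "B = mat n n (\<lambda>(j, i). A\<^sup>T $$ (c j, i))"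
  have cl: "c j < n" if "j < n" for j using permutes_in_image[OF c, of j] that by simp
  have rl: "r j < n" if "j < n" for j using permutes_in_image[OF r, of j] that by simp
  have B: "B \<in> carrier_mat n n" by (simp add: B_def)
  have "det B = signof c * det A"
    unfolding B_def using det_permute_rows[of "A\<^sup>T" n c] A c by (simp add: det_transpose[OF A])
  moreover have "mat n n (\<lambda>(i, j). A $$ (r i, c j)) = mat n n (\<lambda>(i, j). B\<^sup>T $$ (r i, j))"
    using A cl rl by (intro eq_matI) (auto simp: B_def)
  moreover have "det (mat n n (\<lambda>(i, j). B\<^sup>T $$ (r i, j))) = signof r * det B"
    using det_permute_rows[of "B\<^sup>T" n r] B r by (simp add: det_transpose[OF B])
  ultimately show ?thesis by (simp add: abs_mult sign_def)
qed

text \<open>Subtracting from the right block columns the left ones times \<open>X\<close> is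
  multiplication by a unitriangular matrix. Here \<open>E\<close> plays the role of the Schur
  complement, but giving \<open>X\<close> explicitly avoids the inverse of \<open>A\<close>, which
  may be singular.\<close>

lemma det_four_block_mat_eliminate:
  fixes A :: "'a :: idom mat"
  assumes A: "A \<in> carrier_mat n n" and X: "X \<in> carrier_mat n m"
    and C: "C \<in> carrier_mat m n" and E: "E \<in> carrier_mat m m"
  shows "det (four_block_mat A (A * X) C (C * X + E)) = det A * det E"
proof -
  have "four_block_mat A (A * X) C (C * X + E)
      = four_block_mat A (0\<^sub>m n m) C E * four_block_mat (1\<^sub>m n) X (0\<^sub>m m n) (1\<^sub>m m)"
    using assms by (subst mult_four_block_mat[where ?n1.0 = n and ?n2.0 = m]) auto
  also have "det \<dots> = det (four_block_mat A (0\<^sub>m n m) C E)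
      * det (four_block_mat (1\<^sub>m n) X (0\<^sub>m m n) (1\<^sub>m m))"
    using assms by (intro det_mult[of _ "n + m"]) auto
  also have "det (four_block_mat A (0\<^sub>m n m) C E) = det A * det E"
    by (rule det_four_block_mat_upper_right_zero[OF A refl C E])
  also have "det (four_block_mat (1\<^sub>m n) X (0\<^sub>m m n) (1\<^sub>m m)) = 1"
    using det_four_block_mat_lower_left_zero[OF one_carrier_mat X refl one_carrier_mat] by simp
  finally show ?thesis by simp
qed

text \<open>Bijections from the first \<open>p\<close> positions onto a \<open>p\<close>-element
  subset \<open>Q\<close> of \<open>P\<close>, and from the rest onto its complement, are glued.
  Nothing is claimed about the later positions: elements of \<open>P\<close> outside
  \<open>Q\<close> land there.\<close>

lemma exists_permutation_into:
  assumes P: "P \<subseteq> {0..<n :: nat}" and p: "p \<le> card P"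
  shows "\<exists>r. r permutes {0..<n} \<and> (\<forall>i<p. r i \<in> P)"
proof -
  obtain Q where Q: "Q \<subseteq> P" "card Q = p" "finite Q"
    using obtain_subset_with_card_n[OF p] by metis
  have pn: "p \<le> n" using p card_mono[OF _ P] by simp
  obtain f where f: "bij_betw f {0..<p} Q"
    using finite_same_card_bij[of "{0..<p}" Q] Q by auto
  have "card ({0..<n} - Q) = n - p"
    using Q P by (subst card_Diff_subset) auto
  then obtain g where g: "bij_betw g {p..<n} ({0..<n} - Q)"
    using finite_same_card_bij[of "{p..<n}" "{0..<n} - Q"] by auto
  define r where "r i = (if i < p then f i else if i < n then g i else i)" for i
  have "bij_betw r {0..<p} Q" using f by (rule bij_betw_cong[THEN iffD1, rotated]) (auto simp: r_def)
  moreover have "bij_betw r {p..<n} ({0..<n} - Q)"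
    using g by (rule bij_betw_cong[THEN iffD1, rotated]) (auto simp: r_def)
  ultimately have "bij_betw r ({0..<p} \<union> {p..<n}) (Q \<union> ({0..<n} - Q))"
    by (rule bij_betw_combine) auto
  moreover have "{0..<p} \<union> {p..<n} = {0..<n}" "Q \<union> ({0..<n} - Q) = {0..<n}"
    using pn Q P by auto
  ultimately have "r permutes {0..<n}"
    using pn by (intro bij_imp_permutes) (auto simp: r_def)
  moreover have "\<forall>i<p. r i \<in> P"
    using f Q by (auto simp: r_def bij_betw_def)
  ultimately show ?thesis by blast
qed

text \<open>Pigeonhole: two levels taken at most \<open>k\<close> times each would account for only
  \<open>2 * k\<close> runs.\<close>

lemma exists_majority_sign:
  fixes s :: "nat \<Rightarrow> real"
  assumes "\<And>i. i < 2 * k + 1 \<Longrightarrow> s i = 1 \<or> s i = -1"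
  shows "\<exists>\<sigma>. (\<sigma> = 1 \<or> \<sigma> = -1) \<and> k + 1 \<le> card {i \<in> {0..<2 * k + 1}. s i = \<sigma>}"
proof -
  define P where "P \<tau> = {i \<in> {0..<2 * k + 1}. s i = \<tau>}" for \<tau>
  have "{0..<2 * k + 1} = P 1 \<union> P (-1)"
    using assms by (fastforce simp: P_def)
  then have "2 * k + 1 \<le> card (P 1) + card (P (-1))"
    using card_Un_le[of "P 1" "P (-1)"] by (metis card_atLeastLessThan diff_zero)
  then have "k + 1 \<le> card (P 1) \<or> k + 1 \<le> card (P (-1))" by linarith
  then show ?thesis unfolding P_def by blast
qed

text \<open>Columns count from 0 and factors from 1, so column \<open>j\<close> holds
  \<open>F (Suc j)\<close> and its interaction with the first factor stands \<open>k\<close> places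
  further right. The case \<open>j = 0\<close> is the mean.\<close>

lemma G1_one_interaction:
  assumes D: "D \<in> G1_one k" and i: "i < 2 * k + 1" and j: "j < k"
  shows "D $$ (i, k + j) = D $$ (i, 0) * D $$ (i, j)"
proof -
  obtain F e where F: "\<forall>j\<in>{1..k}. F j \<in> carrier_vec (2 * k + 1)"
    and D_eq: "D = mat_of_cols (2 * k + 1)
             (map F [1..<k + 1] @ map (\<lambda>j. F 1 \<star> F j) [1..<k + 1] @ [e])"
    using D by (auto simp: G1_one_def)
  have main: "D $$ (i, l) = F (Suc l) $ i" if "l < k" for l
    unfolding D_eq using i that
    by (subst mat_of_cols_index) (auto simp: nth_append simp del: upt_Suc)
  have "D $$ (i, k + j) = (F 1 \<star> F (Suc j)) $ i"
    unfolding D_eq using i j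
    by (subst mat_of_cols_index) (auto simp: nth_append simp del: upt_Suc)
  also have "\<dots> = F 1 $ i * F (Suc j) $ i"
    using F[rule_format, of 1] i j by (simp add: schur_prod_def)
  finally show ?thesis using main[of 0] main[OF j] j by simp
qed

theorem theorem3:
  fixes k :: nat and D :: "real mat"
  assumes "k \<ge> 1" and "D \<in> G1_one k"
  shows "\<bar>det D\<bar> \<le> 2 ^ k * Theta k * Theta (k + 1)"
proof -
  define n where "n = 2 * k + 1"
  have D: "D \<in> sign_mats n" using assms(2) by (simp add: G1_one_def n_def)
  then have D_carrier: "D \<in> carrier_mat n n" and det_D: "det D \<noteq> 0"
    by (auto simp: sign_mats_def)
  have entry: "D $$ (i, j) = 1 \<or> D $$ (i, j) = -1" if "i < n" "j < n" for i j
    using sign_mats_entry[OF D that] .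
  have inter: "D $$ (i, k + j) = D $$ (i, 0) * D $$ (i, j)" if "i < n" "j < k" for i j
    using G1_one_interaction[OF assms(2), of i j] that by (simp add: n_def)
  obtain \<sigma> where \<sigma>: "\<sigma> = 1 \<or> \<sigma> = -1"
    and "k + 1 \<le> card {i \<in> {0..<n}. D $$ (i, 0) = \<sigma>}"
    using exists_majority_sign[of k "\<lambda>i. D $$ (i, 0)"] entry unfolding n_def by auto
  then obtain r where r: "r permutes {0..<n}"
    and r_top: "\<And>i. i < k + 1 \<Longrightarrow> D $$ (r i, 0) = \<sigma>"
    using exists_permutation_into[of "{i \<in> {0..<n}. D $$ (i, 0) = \<sigma>}" n "k + 1"] by fastforce
  have r_less: "r i < n" if "i < n" for i using permutes_in_image[OF r, of i] that by simp
  \<comment> \<open>The extra column \<open>2 * k\<close> moves to position \<open>k\<close> and the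
    interactions shift right by one, so the left \<open>k + 1\<close> columns are the main effects
    followed by \<open>e\<close>.\<close>
  define c where "c j = (if j < k then j else if j = k then 2 * k else if j < n then j - 1 else j)"
    for j
  have "bij_betw c {0..<n} {0..<n}"
    by (rule bij_betw_byWitness[where
          f' = "\<lambda>j. if j < k then j else if j = 2 * k then k else if j < n then j + 1 else j"])
      (auto simp: c_def n_def)
  then have c: "c permutes {0..<n}"
    by (rule bij_imp_permutes) (auto simp: c_def n_def)
  have c_less: "c j < n" if "j < n" for j using permutes_in_image[OF c, of j] that by simp
  define A where "A = mat (k + 1) (k + 1) (\<lambda>(i, j). D $$ (r i, c j))"
  define C where "C = mat k (k + 1) (\<lambda>(i, j). D $$ (r (k + 1 + i), c j))"
  define B where "B = mat k k (\<lambda>(i, j). D $$ (r (k + 1 + i), j))"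
  \<comment> \<open>What is left of the lower interactions after the subtraction; the level of the
    first factor in these runs is not yet known.\<close>
  define E where "E = mat k k (\<lambda>(i, j). (D $$ (r (k + 1 + i), 0) - \<sigma>) * B $$ (i, j))"
  \<comment> \<open>Right multiplication by \<open>X\<close> yields \<sigma> times the first
    \<open>k\<close> columns; its zero last row drops the column \<open>e\<close>.\<close>
  define X where "X = mat (k + 1) k (\<lambda>(i, j). if i = j then \<sigma> else 0)"
  have carriers: "A \<in> carrier_mat (k + 1) (k + 1)" "C \<in> carrier_mat k (k + 1)"
    "B \<in> carrier_mat k k" "E \<in> carrier_mat k k" "X \<in> carrier_mat (k + 1) k"
    by (auto simp: A_def C_def B_def E_def X_def)
  have mult_X: "(M * X) $$ (i, j) = \<sigma> * M $$ (i, j)"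
    if "M \<in> carrier_mat q (k + 1)" "i < q" "j < k" for M q i j
  proof -
    have "(M * X) $$ (i, j) = (\<Sum>l = 0..<k + 1. if l = j then \<sigma> * M $$ (i, l) else 0)"
      using that by (simp add: X_def scalar_prod_def if_distrib mult.commute cong: if_cong)
    then show ?thesis using that by simp
  qed
  have "mat n n (\<lambda>(i, j). D $$ (r i, c j)) = four_block_mat A (A * X) C (C * X + E)"
  proof (rule eq_matI)
    fix i j
    assume "i < dim_row (four_block_mat A (A * X) C (C * X + E))"
      and "j < dim_col (four_block_mat A (A * X) C (C * X + E))"
    then have i: "i < n" and j: "j < n" using carriers by (auto simp: n_def)
    show "mat n n (\<lambda>(i, j). D $$ (r i, c j)) $$ (i, j)
        = four_block_mat A (A * X) C (C * X + E) $$ (i, j)"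
    proof (cases "j < k + 1")
      case True
      then show ?thesis using i j carriers by (auto simp: A_def C_def n_def)
    next
      case False
      define l where "l = j - (k + 1)"
      have l: "l < k" "j = k + 1 + l" "c j = k + l" "c l = l"
        using False j by (auto simp: l_def n_def c_def)
      have eq: "D $$ (r i, c j) = D $$ (r i, 0) * D $$ (r i, l)"
        using inter[OF r_less[OF i] l(1)] l by simp
      show ?thesis
      proof (cases "i < k + 1")
        case True
        have "(A * X) $$ (i, l) = \<sigma> * A $$ (i, l)"
          using True l carriers by (intro mult_X) auto
        then show ?thesis using True i j l carriers eq r_top[OF True] by (simp add: A_def n_def)
      next
        case False
        define h where "h = i - (k + 1)"
        have h: "h < k" "i = k + 1 + h" using False i by (auto simp: h_def n_def)
        have "(C * X) $$ (h, l) = \<sigma> * C $$ (h, l)"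
          using h l carriers by (intro mult_X) auto
        then show ?thesis using h i j l carriers eq
          by (simp add: C_def E_def B_def n_def algebra_simps)
      qed
    qed
  qed (use carriers in \<open>auto simp: n_def\<close>)
  then have abs_D: "\<bar>det D\<bar> = \<bar>det A\<bar> * \<bar>det E\<bar>"
    using abs_det_permute_rows_cols[OF D_carrier r c]
      det_four_block_mat_eliminate[of A "k + 1" X k C E] carriers
    by (simp add: abs_mult)
  then have det_A: "det A \<noteq> 0" and det_E: "det E \<noteq> 0" using det_D by auto
  \<comment> \<open>A lower run at level \<sigma> would give \<open>E\<close> a zero row.\<close>
  have bottom: "D $$ (r (k + 1 + i), 0) = -\<sigma>" if i: "i < k" for i
  proof -
    have "D $$ (r (k + 1 + i), 0) \<noteq> \<sigma>"
    proof
      assume "D $$ (r (k + 1 + i), 0) = \<sigma>"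
      then have "det E = 0"
        using carriers(4) i by (intro det_zero_row[of E k i]) (auto simp: E_def)
      with det_E show False by simp
    qed
    then show ?thesis
      using entry[of "r (k + 1 + i)" 0] r_less[of "k + 1 + i"] i \<sigma> by (auto simp: n_def)
  qed
  have "E = (-2 * \<sigma>) \<cdot>\<^sub>m B"
    using carriers bottom by (intro eq_matI) (auto simp: E_def B_def)
  then have abs_E: "\<bar>det E\<bar> = 2 ^ k * \<bar>det B\<bar>" and det_B: "det B \<noteq> 0"
    using carriers \<sigma> det_E by (auto simp: abs_mult power_abs)
  have "A \<in> sign_mats (k + 1)"
    using carriers det_A entry r_less c_less by (intro sign_matsI) (auto simp: A_def n_def)
  \<comment> \<open>Since \<open>k \<ge> 1\<close>, \<open>c 0 = 0\<close>: the first column of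
    \<open>A\<close> is the first factor, not \<open>e\<close>, and is constantly \<sigma> by the
    choice of \<open>r\<close>.\<close>
  then have A_le: "\<bar>det A\<bar> \<le> Theta (k + 1)"
    using r_top assms(1) by (intro abs_det_le_Theta[OF _ _ \<sigma>]) (auto simp: A_def c_def)
  have "B \<in> sign_mats k"
    using carriers det_B entry r_less by (intro sign_matsI) (auto simp: B_def n_def)
  then have B_le: "\<bar>det B\<bar> \<le> Theta k"
    using bottom assms(1) \<sigma> by (intro abs_det_le_Theta[of _ _ "-\<sigma>"]) (auto simp: B_def)
  have "\<bar>det D\<bar> = 2 ^ k * (\<bar>det B\<bar> * \<bar>det A\<bar>)"
    using abs_D abs_E by simp
  also have "\<dots> \<le> 2 ^ k * (Theta k * Theta (k + 1))"
    using A_le B_le by (intro mult_left_mono mult_mono) auto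
  finally show ?thesis by (simp add: mult.assoc)
qed

end
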